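(* For every $m\ge 1$ and all convex functions $f_1,\dots,f_m:(0,\infty)\to\mathbb{R}$ with $f_i(1)=0$ for each $i$, we have $$\mathcal{R}(f_1,\dots,f_m)=\mathcal{R}_{m+2}(f_1,\dots,f_m).$$
   Context: For a convex function $f:(0,\infty)\to\mathbb{R}$ with $f(1)=0$, put $f(0):=\lim_{x\downarrow 0}f(x)$ and $f'(\infty):=\lim_{x\uparrow\infty}f(x)/x$ (both exist, possibly $+\infty$). For probability measures $P,Q$ on a common measurable space with densities $p,q$ with respect to a common dominating measure $\lambda$, the $f$-divergence is $D_f(P||Q):=\int_{\{q>0\}} f(p/q)\,dQ+f'(\infty)P\{q=0\}$ (with $\infty\cdot 0=0$). The joint range $\mathcal{R}(f_1,\dots,f_m)$ is the set of all vectors in $\mathbb{R}^m$ that equal $(D_{f_1}(P||Q),\dots,D_{f_m}(P||Q))$ for some pair of probability measures $P,Q$ on some measurable space. For $k\ge1$, $\mathcal{P}_k$ is the set of all probability measures on $\{1,\dots,k\}$, and $\mathcal{R}_k(f_1,\dots,f_m)$ is the set of all vectors in $\mathbb{R}^m$ that equal $(D_{f_1}(P||Q),\dots,D_{f_m}(P||Q))$ for some $P,Q\in\mathcal{P}_k$. *)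

theory Defs
  imports "HOL-Probability.Probability"
begin

definition f_at_zero :: "(real \<Rightarrow> real) \<Rightarrow> ereal" where
  "f_at_zero f = Lim (at_right 0) (\<lambda>x. ereal (f x))"

definition f_slope_infinity :: "(real \<Rightarrow> real) \<Rightarrow> ereal" where
  "f_slope_infinity f = Lim at_top (\<lambda>x. ereal (f x / x))"

definition f_ext :: "(real \<Rightarrow> real) \<Rightarrow> real \<Rightarrow> ereal" where
  "f_ext f x = (if x = 0 then f_at_zero f else ereal (f x))"

text \<open>The Lebesgue integral of an extended-real function over \<open>A\<close>, as integral of the positive
  part minus integral of the negative part (\<open>e2ennreal\<close> truncates negative values to \<open>0\<close>).
  For convex \<open>f\<close> with \<open>f 1 = 0\<close> the function \<open>f\<close> is bounded below by some \<open>c * (x - 1)\<close>, so in the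
  definition of the divergence below the second integral is finite.\<close>

definition set_ereal_integral :: "'a measure \<Rightarrow> 'a set \<Rightarrow> ('a \<Rightarrow> ereal) \<Rightarrow> ereal" where
  "set_ereal_integral M A g =
     enn2ereal (\<integral>\<^sup>+x\<in>A. e2ennreal (g x) \<partial>M) - enn2ereal (\<integral>\<^sup>+x\<in>A. e2ennreal (- g x) \<partial>M)"

definition common_densities ::
  "'a measure \<Rightarrow> ('a \<Rightarrow> real) \<Rightarrow> ('a \<Rightarrow> real) \<Rightarrow> 'a measure \<Rightarrow> 'a measure \<Rightarrow> bool" where
  "common_densities L p q P Q \<longleftrightarrow>
     p \<in> borel_measurable L \<and> q \<in> borel_measurable L \<and>
     (\<forall>x\<in>space L. 0 \<le> p x \<and> 0 \<le> q x) \<and>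
     P = density L (\<lambda>x. ennreal (p x)) \<and> Q = density L (\<lambda>x. ennreal (q x))"

definition f_divergence_dens ::
  "(real \<Rightarrow> real) \<Rightarrow> ('a \<Rightarrow> real) \<Rightarrow> ('a \<Rightarrow> real) \<Rightarrow> 'a measure \<Rightarrow> 'a measure \<Rightarrow> ereal" where
  "f_divergence_dens f p q P Q =
     set_ereal_integral Q {x \<in> space Q. q x > 0} (\<lambda>x. f_ext f (p x / q x)) +
     f_slope_infinity f * ereal (measure P {x \<in> space P. q x = 0})"

text \<open>The value does not depend on the dominating measure \<open>L\<close> and the densities; the lemmas
  \<open>common_densities_exist\<close> and \<open>f_divergence_eq\<close> below show that the description is proper.\<close>

definition f_divergence :: "(real \<Rightarrow> real) \<Rightarrow> 'a measure \<Rightarrow> 'a measure \<Rightarrow> ereal" where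
  "f_divergence f P Q =
     (THE d. \<exists>L p q. common_densities L p q P Q \<and> d = f_divergence_dens f p q P Q)"

text \<open>Vectors with real coordinates only: a pair \<open>(P, Q)\<close> with an infinite divergence contributes
  nothing. HOL cannot quantify over all measurable spaces at once, so the joint range is taken
  relative to a type \<open>'a\<close> containing the underlying spaces; the space is any set of elements
  of \<open>'a\<close> with any sigma-algebra.\<close>

definition joint_range :: "'a itself \<Rightarrow> ('m::finite \<Rightarrow> real \<Rightarrow> real) \<Rightarrow> (real ^ 'm) set" where
  "joint_range _ f =
     {v. \<exists>P Q :: 'a measure. prob_space P \<and> prob_space Q \<and> sets P = sets Q \<and>
           (\<forall>i. ereal (v $ i) = f_divergence (f i) P Q)}"

definition prob_measures_upto :: "nat \<Rightarrow> nat measure set" where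
  "prob_measures_upto k = {P. prob_space P \<and> space P = {1..k} \<and> sets P = Pow {1..k}}"

definition joint_range_upto :: "nat \<Rightarrow> ('m::finite \<Rightarrow> real \<Rightarrow> real) \<Rightarrow> (real ^ 'm) set" where
  "joint_range_upto k f =
     {v. \<exists>P\<in>prob_measures_upto k. \<exists>Q\<in>prob_measures_upto k.
           \<forall>i. ereal (v $ i) = f_divergence (f i) P Q}"


lemma common_densities_exist:
  assumes P: "prob_space P" and Q: "prob_space Q" and s: "sets P = sets Q"
  shows "\<exists>L p q. common_densities L p q P Q"
proof -
  interpret P: prob_space P by fact
  interpret Q: prob_space Q by fact
  define L where "L = measure_of (space P) (sets P) (\<lambda>A. emeasure P A + emeasure Q A)"
  have setsL: "sets L = sets P" and spaceL: "space L = space P"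
    by (simp_all add: L_def)
  have ca: "countably_additive (sets P) (\<lambda>A. emeasure P A + emeasure Q A)"
  proof (rule countably_additiveI)
    fix A :: "nat \<Rightarrow> 'a set"
    assume "range A \<subseteq> sets P" "disjoint_family A" "(\<Union>i. A i) \<in> sets P"
    then show "(\<Sum>i. emeasure P (A i) + emeasure Q (A i)) =
        emeasure P (\<Union>i. A i) + emeasure Q (\<Union>i. A i)"
      using suminf_emeasure[of A P] suminf_emeasure[of A Q] s
      by (simp add: suminf_add[symmetric])
  qed
  have eL: "emeasure L A = emeasure P A + emeasure Q A" if "A \<in> sets P" for A
    unfolding L_def using that ca
    by (intro emeasure_measure_of_sigma) (auto simp: positive_def sets.sigma_algebra_axioms)
  have "finite_measure L"
    using s sets_eq_imp_space_eq[OF s]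
    by (intro finite_measureI)
       (simp add: spaceL eL P.emeasure_space_1 Q.emeasure_space_1)
  then interpret L: finite_measure L .
  have dens: "\<exists>d. d \<in> borel_measurable L \<and> (\<forall>x. 0 \<le> d x) \<and> N = density L (\<lambda>x. ennreal (d x))"
    if N: "finite_measure N" "absolutely_continuous L N" "sets N = sets L" for N
  proof -
    obtain D where D: "D \<in> borel_measurable L" "AE x in L. RN_deriv L N x = ennreal (D x)"
        "\<And>x. 0 \<le> D x"
      using L.real_RN_deriv[OF N] by blast
    have "density L (RN_deriv L N) = density L (\<lambda>x. ennreal (D x))"
      using D by (intro density_cong) auto
    then show ?thesis
      using D L.density_RN_deriv[OF N(2,3)] by auto
  qed
  have "absolutely_continuous L P" "absolutely_continuous L Q"
    using s by (auto simp: absolutely_continuous_def null_sets_def setsL eL)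
  then obtain p q where
    "p \<in> borel_measurable L" "\<forall>x. 0 \<le> p x" "P = density L (\<lambda>x. ennreal (p x))"
    "q \<in> borel_measurable L" "\<forall>x. 0 \<le> q x" "Q = density L (\<lambda>x. ennreal (q x))"
    using dens[of P] dens[of Q] P.finite_measure_axioms Q.finite_measure_axioms s setsL by metis
  then show ?thesis
    unfolding common_densities_def by blast
qed

lemma common_densities_facts:
  assumes d: "common_densities L p q P Q"
  shows "sets P = sets L" "sets Q = sets L" "space P = space L" "space Q = space L"
    and "p \<in> borel_measurable L" "q \<in> borel_measurable L"
    and "{x \<in> space L. q x = 0} \<in> null_sets Q"
    and "A \<in> sets L \<Longrightarrow> (\<integral>\<^sup>+x\<in>A. ennreal (p x / q x) \<partial>Q) = emeasure P (A \<inter> {x \<in> space L. q x > 0})"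
proof -
  have p[measurable]: "p \<in> borel_measurable L" and q[measurable]: "q \<in> borel_measurable L"
    and nn: "\<And>x. x \<in> space L \<Longrightarrow> 0 \<le> p x \<and> 0 \<le> q x"
    and P: "P = density L (\<lambda>x. ennreal (p x))" and Q: "Q = density L (\<lambda>x. ennreal (q x))"
    using d by (auto simp: common_densities_def)
  show "sets P = sets L" "sets Q = sets L" "space P = space L" "space Q = space L"
    "p \<in> borel_measurable L" "q \<in> borel_measurable L"
    by (simp_all add: P Q)
  show "{x \<in> space L. q x = 0} \<in> null_sets Q"
    unfolding Q by (subst null_sets_density_iff) auto
  assume A[measurable]: "A \<in> sets L"
  have "(\<integral>\<^sup>+x\<in>A. ennreal (p x / q x) \<partial>Q) =
      (\<integral>\<^sup>+x. ennreal (q x) * (ennreal (p x / q x) * indicator A x) \<partial>L)"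
    unfolding Q by (subst nn_integral_density) auto
  also have "\<dots> = (\<integral>\<^sup>+x. ennreal (p x) * indicator (A \<inter> {x \<in> space L. q x > 0}) x \<partial>L)"
  proof (rule nn_integral_cong)
    fix x assume x: "x \<in> space L"
    have "ennreal (q x) * ennreal (p x / q x) = ennreal (p x)" if "q x > 0"
      using nn[OF x] that by (simp add: ennreal_mult[symmetric])
    then show "ennreal (q x) * (ennreal (p x / q x) * indicator A x) =
        ennreal (p x) * indicator (A \<inter> {x \<in> space L. q x > 0}) x"
      using nn[OF x] x by (cases "q x > 0") (auto simp: indicator_def)
  qed
  also have "\<dots> = emeasure P (A \<inter> {x \<in> space L. q x > 0})"
    unfolding P by (subst emeasure_density) auto
  finally show "(\<integral>\<^sup>+x\<in>A. ennreal (p x / q x) \<partial>Q) = emeasure P (A \<inter> {x \<in> space L. q x > 0})" .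
qed

lemma common_densities_positive_part:
  assumes d: "common_densities L p q P Q" and d': "common_densities L' p' q' P Q"
    and A: "A \<in> sets P"
  shows "emeasure P (A \<inter> {x \<in> space L. q x > 0}) \<le> emeasure P (A \<inter> {x \<in> space L'. q' x > 0})"
proof -
  note F = common_densities_facts[OF d] and F' = common_densities_facts[OF d']
  have s: "sets L' = sets L" using F F' by simp
  have sp: "space L' = space L" using F F' by simp
  have [measurable]: "q \<in> borel_measurable L" "q' \<in> borel_measurable L" "A \<in> sets L"
    using F F' A measurable_cong_sets[OF s refl] by auto
  let ?N = "{x \<in> space L. q' x = 0}"
  have N: "?N \<in> null_sets Q" using F'(7) sp by simp
  have Z: "emeasure P (?N \<inter> {x \<in> space L. q x > 0}) = 0"
  proof -
    have "(\<integral>\<^sup>+x\<in>?N. ennreal (p x / q x) \<partial>Q) = 0"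
      by (rule nn_integral_null_set[OF N])
    then show ?thesis using F(8)[of ?N] by simp
  qed
  have nn: "\<forall>x\<in>space L. 0 \<le> q' x" using d' sp by (simp add: common_densities_def)
  have "emeasure P (A \<inter> {x \<in> space L. q x > 0}) \<le>
      emeasure P ((A \<inter> {x \<in> space L'. q' x > 0}) \<union> (?N \<inter> {x \<in> space L. q x > 0}))"
    using nn F(1) by (intro emeasure_mono) (auto simp: sp less_le)
  also have "\<dots> \<le> emeasure P (A \<inter> {x \<in> space L'. q' x > 0}) +
      emeasure P (?N \<inter> {x \<in> space L. q x > 0})"
    using F(1) by (intro emeasure_subadditive) (auto simp: sp)
  finally show ?thesis using Z by simp
qed

lemma f_divergence_dens_unique:
  assumes Pp: "prob_space P"
    and d: "common_densities L p q P Q" and d': "common_densities L' p' q' P Q"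
  shows "f_divergence_dens f p q P Q = f_divergence_dens f p' q' P Q"
proof -
  interpret P: prob_space P by fact
  note F = common_densities_facts[OF d] and F' = common_densities_facts[OF d']
  have eq: "emeasure P (A \<inter> {x \<in> space L. q x > 0}) = emeasure P (A \<inter> {x \<in> space L'. q' x > 0})"
    if "A \<in> sets P" for A
    using common_densities_positive_part[OF d d' that] common_densities_positive_part[OF d' d that]
    by (rule antisym)
  have mQ[measurable]: "p \<in> borel_measurable Q" "q \<in> borel_measurable Q"
      "p' \<in> borel_measurable Q" "q' \<in> borel_measurable Q"
    using F(5,6) F'(5,6) measurable_cong_sets[OF F(2) refl] measurable_cong_sets[OF F'(2) refl]
    by auto
  have mP[measurable]: "q \<in> borel_measurable P" "q' \<in> borel_measurable P"
    using F(6) F'(6) measurable_cong_sets[OF F(1) refl] measurable_cong_sets[OF F'(1) refl]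
    by auto
  have nnq: "0 \<le> p x \<and> 0 \<le> q x \<and> 0 \<le> p' x \<and> 0 \<le> q' x" if "x \<in> space Q" for x
    using d d' that F(4) F'(4) by (auto simp: common_densities_def)
  have sp: "space P = space Q" using F by simp
  let ?g = "\<lambda>x. ennreal (p x / q x)" and ?g' = "\<lambda>x. ennreal (p' x / q' x)"
  have "density Q ?g = density Q ?g'"
  proof (rule measure_eqI)
    fix A assume "A \<in> sets (density Q ?g)"
    then have A: "A \<in> sets L" "A \<in> sets L'" "A \<in> sets P" "A \<in> sets Q" using F F' by auto
    show "emeasure (density Q ?g) A = emeasure (density Q ?g') A"
      using A F(8)[of A] F'(8)[of A] eq[of A] by (simp add: emeasure_density)
  qed simp
  moreover have "integral\<^sup>N Q ?g \<noteq> \<infinity>"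
  proof -
    have "integral\<^sup>N Q ?g = (\<integral>\<^sup>+x\<in>space L. ?g x \<partial>Q)"
      using F(4) by (intro nn_integral_cong) auto
    also have "\<dots> = emeasure P (space L \<inter> {x \<in> space L. q x > 0})"
      using F(8)[of "space L"] by simp
    finally show ?thesis by simp
  qed
  ultimately have "AE x in Q. ?g x = ?g' x"
    by (subst (asm) finite_density_unique) auto
  moreover have "AE x in Q. q x \<noteq> 0" "AE x in Q. q' x \<noteq> 0"
    using AE_not_in[OF F(7)] AE_not_in[OF F'(7)] AE_space[of Q] F(4) F'(4) by auto
  ultimately have ae: "AE x in Q. q x > 0 \<and> q' x > 0 \<and> p x / q x = p' x / q' x"
    using AE_space[of Q]
  proof eventually_elim
    case (elim x)
    then show ?case using nnq[of x] by (auto simp: less_le)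
  qed
  have "(\<integral>\<^sup>+x\<in>{x \<in> space Q. q x > 0}. h (p x / q x) \<partial>Q) =
      (\<integral>\<^sup>+x\<in>{x \<in> space Q. q' x > 0}. h (p' x / q' x) \<partial>Q)" for h :: "real \<Rightarrow> ennreal"
    using ae by (intro nn_integral_cong_AE) (auto simp: indicator_def)
  note this[of "\<lambda>t. e2ennreal (f_ext f t)"] this[of "\<lambda>t. e2ennreal (- f_ext f t)"]
  moreover have "measure P {x \<in> space P. q x = 0} = measure P {x \<in> space P. q' x = 0}"
  proof -
    have "{x \<in> space P. q x = 0} = space P - {x \<in> space P. q x > 0}"
      "{x \<in> space P. q' x = 0} = space P - {x \<in> space P. q' x > 0}"
      using nnq sp by (force simp: less_le)+
    moreover have "emeasure P {x \<in> space P. q x > 0} = emeasure P {x \<in> space P. q' x > 0}"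
    proof -
      have "space P \<inter> {x \<in> space L. q x > 0} = {x \<in> space P. q x > 0}"
        "space P \<inter> {x \<in> space L'. q' x > 0} = {x \<in> space P. q' x > 0}"
        using F(3) F'(3) by auto
      then show ?thesis using eq[of "space P"] by simp
    qed
    ultimately show ?thesis
      using P.prob_compl[of "{x \<in> space P. q x > 0}"] P.prob_compl[of "{x \<in> space P. q' x > 0}"]
      by (simp add: measure_def)
  qed
  ultimately show ?thesis
    by (simp add: f_divergence_dens_def set_ereal_integral_def)
qed

lemma f_divergence_eq:
  assumes "prob_space P" and "common_densities L p q P Q"
  shows "f_divergence f P Q = f_divergence_dens f p q P Q"
  unfolding f_divergence_def
  using f_divergence_dens_unique[OF assms(1)] assms(2) by (intro the_equality) blast+

end

theory Submission
  imports Defs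
begin

text \<open>Let \<open>M = (P + Q) / 2\<close> and let \<open>a\<close> be the density of \<open>Q / 2\<close> with respect to \<open>M\<close>. Then
  \<open>D_f(P||Q)\<close> is twice the \<open>M\<close>-mean of \<open>a f((1 - a) / a)\<close>, so \<open>(1/2, v/2)\<close> is the mean of a random
  point on a curve in dimension \<open>m + 1\<close>. The mean of a random point lies in the convex hull (no closure
  needed) of any set containing the point almost surely: otherwise a separating hyperplane through
  the mean contains the point almost surely, and the dimension drops. By Caratheodory's theorem
  \<open>m + 2\<close> points of the curve suffice, and they are the values of \<open>a\<close> on the atoms of the new pair.\<close>

section \<open>Means of random points and convex hulls\<close>

lemma (in prob_space) zero_in_convex_hull_if_expectation_zero:
  fixes X :: "'a \<Rightarrow> 'b::euclidean_space"
  assumes int: "integrable M X" and exp0: "expectation X = 0" and S: "AE x in M. X x \<in> S"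
  shows "0 \<in> convex hull S"
  using S
proof (induction "dim S" arbitrary: S rule: less_induct)
  case less
  show ?case
  proof (rule ccontr)
    assume not_in: "0 \<notin> convex hull S"
    have "S \<noteq> {}"
      using less.prems AE_False by auto
    \<comment> \<open>The normal \<open>a\<close> is taken inside the span of \<open>S\<close>. This
      is what lowers the dimension: \<open>a\<close> lies in \<open>span S\<close> but, being
      nonzero, not in the hyperplane orthogonal to itself, which contains the span of the slice of
      \<open>S\<close>. In dimension 0 no such \<open>a\<close> exists, so the induction has no
      separate base case.\<close>
    then obtain a where a: "a \<in> span (convex hull S)" "a \<noteq> 0"
        "\<And>y. y \<in> convex hull S \<Longrightarrow> 0 \<le> a \<bullet> y"
      using separating_hyperplane_set_0_inspan[OF convex_convex_hull _ not_in] convex_hull_eq_empty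
      by metis
    have "AE x in M. 0 \<le> a \<bullet> X x"
      using less.prems by eventually_elim (auto intro: a(3) hull_inc)
    moreover have "expectation (\<lambda>x. a \<bullet> X x) = 0"
      using int exp0 by simp
    ultimately have "AE x in M. a \<bullet> X x = 0"
      using integral_nonneg_eq_0_iff_AE[of M "\<lambda>x. a \<bullet> X x"] int by simp
    then have ae: "AE x in M. X x \<in> S \<inter> {y. a \<bullet> y = 0}"
      using less.prems by eventually_elim auto
    have "span (S \<inter> {y. a \<bullet> y = 0}) \<subseteq> {y. a \<bullet> y = 0}"
      by (intro span_minimal subspace_hyperplane) auto
    moreover have "a \<in> span S"
      using a(1) by (metis convex_hull_subset_span span_mono span_span subsetD)
    ultimately have "span (S \<inter> {y. a \<bullet> y = 0}) \<subset> span S"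
      using a(2) span_mono[of "S \<inter> {y. a \<bullet> y = 0}" S] by auto
    then have "dim (S \<inter> {y. a \<bullet> y = 0}) < dim S"
      by (rule dim_psubset)
    then have "0 \<in> convex hull (S \<inter> {y. a \<bullet> y = 0})"
      using less.hyps ae by blast
    then show False
      using not_in hull_mono[of "S \<inter> {y. a \<bullet> y = 0}" S] by blast
  qed
qed

text \<open>Convex hulls commute with translations, so subtracting the mean reduces the claim to
  mean 0.\<close>

lemma (in prob_space) expectation_in_convex_hull:
  fixes X :: "'a \<Rightarrow> 'b::euclidean_space"
  assumes int: "integrable M X" and S: "AE x in M. X x \<in> S"
  shows "expectation X \<in> convex hull S"
proof -
  let ?z = "expectation X"
  have "0 \<in> convex hull ((+) (- ?z) ` S)"
  proof (rule zero_in_convex_hull_if_expectation_zero)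
    show "integrable M (\<lambda>x. - ?z + X x)" "expectation (\<lambda>x. - ?z + X x) = 0"
      using int by (simp_all add: prob_space)
    show "AE x in M. - ?z + X x \<in> (+) (- ?z) ` S"
      using S by eventually_elim auto
  qed
  then obtain y where "y \<in> convex hull S" "0 = - ?z + y"
    unfolding convex_hull_translation by blast
  then show ?thesis
    by simp
qed

section \<open>Divergences as Bochner integrals of the perspective function\<close>

text \<open>A real difference forces both parts to be finite. From then on the linear calculus of
  Bochner integrals is available. Since \<open>real_of_ereal\<close> sends infinite values to 0, the
  almost-everywhere clause keeps the information that the Bochner integral loses.\<close>

lemma ereal_integral_difference_eq_iff:
  fixes h :: "'a \<Rightarrow> ereal"
  assumes [measurable]: "h \<in> borel_measurable M"
  shows "enn2ereal (\<integral>\<^sup>+x. e2ennreal (h x) \<partial>M) - enn2ereal (\<integral>\<^sup>+x. e2ennreal (- h x) \<partial>M) = ereal v \<longleftrightarrow>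
    (AE x in M. \<bar>h x\<bar> \<noteq> \<infinity>) \<and> has_bochner_integral M (\<lambda>x. real_of_ereal (h x)) v"
    (is "?L \<longleftrightarrow> ?R1 \<and> ?R2")
proof -
  let ?p = "\<integral>\<^sup>+x. e2ennreal (h x) \<partial>M" and ?n = "\<integral>\<^sup>+x. e2ennreal (- h x) \<partial>M"
  have eqs: "?p = (\<integral>\<^sup>+x. ennreal (real_of_ereal (h x)) \<partial>M)"
      "?n = (\<integral>\<^sup>+x. ennreal (- real_of_ereal (h x)) \<partial>M)" if ?R1
  proof -
    have "e2ennreal y = ennreal (real_of_ereal y)" "e2ennreal (- y) = ennreal (- real_of_ereal y)"
      if "\<bar>y\<bar> \<noteq> \<infinity>" for y :: ereal
      using that by (cases y; simp)+
    then show "?p = (\<integral>\<^sup>+x. ennreal (real_of_ereal (h x)) \<partial>M)"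
      "?n = (\<integral>\<^sup>+x. ennreal (- real_of_ereal (h x)) \<partial>M)"
      using \<open>?R1\<close> by (auto intro!: nn_integral_cong_AE elim!: eventually_mono)
  qed
  have fin: "?p \<noteq> top \<and> ?n \<noteq> top" if ?L
    using that by (cases "enn2ereal ?p"; cases "enn2ereal ?n") auto
  have R1: ?R1 if ?L
  proof -
    have "AE x in M. e2ennreal (h x) \<noteq> \<infinity>" "AE x in M. e2ennreal (- h x) \<noteq> \<infinity>"
      using fin[OF that] by (intro nn_integral_noteq_infinite; simp)+
    then show ?thesis
    proof eventually_elim
      case (elim x)
      then show ?case by (cases "h x") auto
    qed
  qed
  have real: "enn2ereal y = ereal (enn2real y)" if "y \<noteq> top" for y
    using that by (cases y) auto
  have int: "integrable M (\<lambda>x. real_of_ereal (h x)) \<longleftrightarrow> ?p \<noteq> top \<and> ?n \<noteq> top" if ?R1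
    by (simp add: real_integrable_def eqs[OF that])
  have val: "enn2ereal ?p - enn2ereal ?n = ereal (\<integral>x. real_of_ereal (h x) \<partial>M)"
    if ?R1 and "integrable M (\<lambda>x. real_of_ereal (h x))"
  proof -
    have "?p \<noteq> top" "?n \<noteq> top"
      using int that by auto
    then have "enn2ereal ?p = ereal (enn2real ?p)" "enn2ereal ?n = ereal (enn2real ?n)"
      using real by blast+
    then have "enn2ereal ?p - enn2ereal ?n = ereal (enn2real ?p - enn2real ?n)"
      by (metis ereal_minus(1))
    also have "enn2real ?p - enn2real ?n = (\<integral>x. real_of_ereal (h x) \<partial>M)"
      unfolding real_lebesgue_integral_def[OF that(2)] eqs[OF that(1)] ..
    finally show ?thesis .
  qed
  show ?thesis
  proof
    assume L: ?L
    note R1 = R1[OF L]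
    moreover have i: "integrable M (\<lambda>x. real_of_ereal (h x))"
      using int[OF R1] fin[OF L] by blast
    ultimately show "?R1 \<and> ?R2"
      using val[OF R1 i] L by (metis ereal.inject has_bochner_integral_integrable)
  next
    assume "?R1 \<and> ?R2"
    then show ?L
      using val by (metis has_bochner_integral_iff)
  qed
qed

text \<open>\<open>f_perspective f a\<close> is \<open>a * f ((1 - a) / a)\<close>, extended to the end points by its limits. Twice
  its integral is the divergence when \<open>a\<close> is the density of \<open>Q / 2\<close> with respect to \<open>(P + Q) / 2\<close>;
  in this form the term for \<open>q = 0\<close> is no longer exceptional.\<close>

definition f_perspective :: "(real \<Rightarrow> real) \<Rightarrow> real \<Rightarrow> ereal" where
  "f_perspective f a =
    (if a = 0 then f_slope_infinity f else if a = 1 then f_at_zero f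
     else ereal (a * f ((1 - a) / a)))"

text \<open>Values of \<open>f\<close> outside the positive axis are arbitrary, so measurability is
  assumed for the truncation by the indicator. The end points are split off, and in between the
  quotient is positive, where \<open>f\<close> and its truncation agree.\<close>

lemma f_perspective_measurable:
  assumes f: "(\<lambda>x. indicator {0<..} x *\<^sub>R f x) \<in> borel_measurable borel"
    and [measurable]: "a \<in> borel_measurable M"
    and a: "\<And>x. x \<in> space M \<Longrightarrow> 0 \<le> a x \<and> a x \<le> 1"
  shows "(\<lambda>x. f_perspective f (a x)) \<in> borel_measurable M"
proof -
  define g where "g x = indicator {0<..} x *\<^sub>R f x" for x :: real
  have [measurable]: "g \<in> borel_measurable borel"
    using f by (simp add: g_def[abs_def])
  have "f_perspective f (a x) = (if a x = 0 then f_slope_infinity f else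
      if a x = 1 then f_at_zero f else ereal (a x * g ((1 - a x) / a x)))" if "x \<in> space M" for x
    using a[OF that] by (auto simp: f_perspective_def g_def indicator_def)
  then show ?thesis
    by (subst measurable_cong) auto
qed

lemma f_ext_measurable:
  assumes f: "(\<lambda>x. indicator {0<..} x *\<^sub>R f x) \<in> borel_measurable borel"
    and [measurable]: "y \<in> borel_measurable M"
    and y: "\<And>x. x \<in> space M \<Longrightarrow> 0 \<le> y x"
  shows "(\<lambda>x. f_ext f (y x)) \<in> borel_measurable M"
proof -
  define g where "g x = indicator {0<..} x *\<^sub>R f x" for x :: real
  have [measurable]: "g \<in> borel_measurable borel"
    using f by (simp add: g_def[abs_def])
  have "f_ext f (y x) = (if y x = 0 then f_at_zero f else ereal (g (y x)))" if "x \<in> space M" for x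
    using y[OF that] by (auto simp: f_ext_def g_def indicator_def)
  then show ?thesis
    by (subst measurable_cong) auto
qed

lemma ennreal_times_e2ennreal: "0 \<le> c \<Longrightarrow> ennreal c * e2ennreal y = e2ennreal (ereal c * y)"
proof (cases "c = 0")
  case False
  assume "0 \<le> c"
  with False show ?thesis
    by (cases y) (auto simp: ennreal_mult'[symmetric] ennreal_mult_top e2ennreal_neg)
qed (simp flip: zero_ereal_def)

text \<open>With p = 2(1 - a) and q = 2a, the integrand q f(p/q) is twice the perspective at a
  wherever a > 0. The set a = 0 has Q-mass 0 and P-mass twice its M-mass, and its factor
  \<open>f_slope_infinity f\<close> is the value of the perspective at 0. Fixing a real value
  \<open>v\<close> leaves infinite divergences out of the equivalence.\<close>

lemma f_divergence_eq_ereal_iff: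
  assumes M: "prob_space M" and [measurable]: "a \<in> borel_measurable M"
    and a: "\<And>x. x \<in> space M \<Longrightarrow> 0 \<le> a x \<and> a x \<le> 1"
    and P: "P = density M (\<lambda>x. ennreal (2 * (1 - a x)))" and Q: "Q = density M (\<lambda>x. ennreal (2 * a x))"
    and "prob_space P"
    and f: "(\<lambda>x. indicator {0<..} x *\<^sub>R f x) \<in> borel_measurable borel"
  shows "f_divergence f P Q = ereal v \<longleftrightarrow>
    (AE x in M. \<bar>f_perspective f (a x)\<bar> \<noteq> \<infinity>) \<and>
    has_bochner_integral M (\<lambda>x. real_of_ereal (f_perspective f (a x))) (v / 2)"
proof -
  interpret prob_space M by fact
  have cd: "common_densities M (\<lambda>x. 2 * (1 - a x)) (\<lambda>x. 2 * a x) P Q"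
    using a by (auto simp: common_densities_def P Q)
  let ?r = "\<lambda>x. (1 - a x) / a x"
  have ratio: "2 * (1 - a x) / (2 * a x) = ?r x" for x
    by (rule mult_divide_mult_cancel_left) simp
  let ?Z = "{x \<in> space M. a x = 0}"
  let ?s = "f_slope_infinity f"
  \<comment> \<open>The integrand of the regular term alone: the points with a = 0 are blanked out
    here and return through \<open>?s\<close>.\<close>
  define h where "h x = (if a x = 0 then 0 else 2 * f_perspective f (a x))" for x
  have pm[measurable]: "(\<lambda>x. f_perspective f (a x)) \<in> borel_measurable M"
    using a by (intro f_perspective_measurable[OF f]) auto
  have [measurable]: "h \<in> borel_measurable M"
    unfolding h_def by measurable
  have [measurable]: "(\<lambda>x. f_ext f (?r x)) \<in> borel_measurable M"
    using a by (intro f_ext_measurable[OF f]) (auto intro!: divide_nonneg_nonneg)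
  have hx: "ereal (2 * a x) * f_ext f (?r x) = h x" if "x \<in> space M" "a x > 0" for x
    using that a[OF that(1)] by (auto simp: h_def f_perspective_def f_ext_def)
  \<comment> \<open>Used with \<open>k\<close> the identity and with \<open>k\<close> negation,
    which treats the positive and the negative part of the integral at once.\<close>
  have conv: "(\<integral>\<^sup>+x\<in>{x \<in> space Q. 2 * a x > 0}. e2ennreal (k (f_ext f (?r x))) \<partial>Q) =
      (\<integral>\<^sup>+x. e2ennreal (k (h x)) \<partial>M)"
    if [measurable]: "k \<in> borel_measurable borel" and k: "\<And>c y. ereal c * k y = k (ereal c * y)" "k 0 = 0"
    for k :: "ereal \<Rightarrow> ereal"
  proof -
    have "(\<integral>\<^sup>+x\<in>{x \<in> space Q. 2 * a x > 0}. e2ennreal (k (f_ext f (?r x))) \<partial>Q) =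
        (\<integral>\<^sup>+x. ennreal (2 * a x) * (e2ennreal (k (f_ext f (?r x))) *
          indicator {x \<in> space M. 2 * a x > 0} x) \<partial>M)"
      unfolding Q by (subst nn_integral_density) auto
    also have "\<dots> = (\<integral>\<^sup>+x. e2ennreal (k (h x)) \<partial>M)"
    proof (rule nn_integral_cong)
      fix x assume x: "x \<in> space M"
      show "ennreal (2 * a x) * (e2ennreal (k (f_ext f (?r x))) *
          indicator {x \<in> space M. 2 * a x > 0} x) = e2ennreal (k (h x))"
      proof (cases "a x = 0")
        case True
        then show ?thesis by (simp add: h_def k e2ennreal_neg)
      next
        case False
        then have "a x > 0" using a[OF x] by simp
        have "ennreal (2 * a x) * e2ennreal (k (f_ext f (?r x))) = e2ennreal (k (h x))"
          using \<open>a x > 0\<close> by (subst ennreal_times_e2ennreal) (simp_all only: k hx[OF x \<open>a x > 0\<close>])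
        then show ?thesis
          using \<open>a x > 0\<close> x by simp
      qed
    qed
    finally show ?thesis .
  qed
  have mP: "measure P {x \<in> space P. 2 * a x = 0} = 2 * prob ?Z"
  proof -
    have "emeasure P ?Z = (\<integral>\<^sup>+x. 2 * indicator ?Z x \<partial>M)"
      unfolding P by (subst emeasure_density) (auto intro!: nn_integral_cong simp: indicator_def)
    also have "\<dots> = ennreal (2 * prob ?Z)"
      by (simp add: nn_integral_cmult emeasure_eq_measure ennreal_mult)
    finally show ?thesis
      by (simp add: P measure_def)
  qed
  have D: "f_divergence f P Q = (enn2ereal (\<integral>\<^sup>+x. e2ennreal (h x) \<partial>M) -
      enn2ereal (\<integral>\<^sup>+x. e2ennreal (- h x) \<partial>M)) + ?s * ereal (2 * prob ?Z)"
    unfolding f_divergence_eq[OF \<open>prob_space P\<close> cd] f_divergence_dens_def set_ereal_integral_def ratio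
    using conv[of "\<lambda>y. y"] conv[of uminus] mP by simp
  have bochner: "has_bochner_integral M (\<lambda>x. real_of_ereal (h x)) (v - 2 * prob ?Z * real_of_ereal ?s)
      \<longleftrightarrow> has_bochner_integral M (\<lambda>x. real_of_ereal (f_perspective f (a x))) (v / 2)"
    (is "?A \<longleftrightarrow> ?B")
  proof -
    \<comment> \<open>The term for q = 0 written as an integrable function supported on
      \<open>?Z\<close>, where \<open>h\<close> vanishes; adding it to \<open>h\<close> restores
      twice the perspective.\<close>
    let ?i = "\<lambda>x. (2 * real_of_ereal ?s) * indicator ?Z x"
    have i: "has_bochner_integral M ?i (2 * prob ?Z * real_of_ereal ?s)"
      using has_bochner_integral_mult_right[OF has_bochner_integral_real_indicator[of ?Z M],
          of "2 * real_of_ereal ?s"]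
      by (simp add: emeasure_eq_measure mult_ac)
    have eq: "real_of_ereal (h x) + ?i x = 2 * real_of_ereal (f_perspective f (a x))"
      if "x \<in> space M" for x
      using that by (auto simp: h_def f_perspective_def)
    show ?thesis
    proof
      assume ?A
      from has_bochner_integral_mult_right[OF has_bochner_integral_add[OF this i], of "1/2"]
      show ?B
        by (rule has_bochner_integral_cong[THEN iffD1, rotated 3]) (auto simp: eq)
    next
      assume ?B
      from has_bochner_integral_diff[OF has_bochner_integral_mult_right[OF this, of 2] i]
      show ?A
        by (rule has_bochner_integral_cong[THEN iffD1, rotated 3]) (auto simp flip: eq)
    qed
  qed
  \<comment> \<open>An infinite slope is allowed exactly when \<open>?Z\<close> is null, in
    agreement with the convention that infinity times 0 is 0.\<close>
  have fin: "(AE x in M. \<bar>h x\<bar> \<noteq> \<infinity>) \<and> (prob ?Z = 0 \<or> \<bar>?s\<bar> \<noteq> \<infinity>) \<longleftrightarrow>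
      (AE x in M. \<bar>f_perspective f (a x)\<bar> \<noteq> \<infinity>)"
  proof -
    have "prob ?Z = 0 \<longleftrightarrow> (AE x in M. a x \<noteq> 0)"
      by (subst prob_eq_0) auto
    then have "(prob ?Z = 0 \<or> \<bar>?s\<bar> \<noteq> \<infinity>) \<longleftrightarrow> (AE x in M. a x = 0 \<longrightarrow> \<bar>?s\<bar> \<noteq> \<infinity>)"
      by (cases "\<bar>?s\<bar> = \<infinity>") auto
    moreover have "\<bar>f_perspective f (a x)\<bar> \<noteq> \<infinity> \<longleftrightarrow> \<bar>h x\<bar> \<noteq> \<infinity> \<and> (a x = 0 \<longrightarrow> \<bar>?s\<bar> \<noteq> \<infinity>)" for x
      by (cases "f_perspective f (a x)") (auto simp: h_def f_perspective_def split: if_splits)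
    ultimately show ?thesis
      by simp
  qed
  have "f_divergence f P Q = ereal v \<longleftrightarrow>
    (enn2ereal (\<integral>\<^sup>+x. e2ennreal (h x) \<partial>M) - enn2ereal (\<integral>\<^sup>+x. e2ennreal (- h x) \<partial>M) =
      ereal (v - 2 * prob ?Z * real_of_ereal ?s)) \<and> (prob ?Z = 0 \<or> \<bar>?s\<bar> \<noteq> \<infinity>)"
  proof -
    \<comment> \<open>An extended-real sum is real only if both summands are; for m = 0 the product
      is 0 whatever the slope.\<close>
    have "I + ?s * ereal (2 * m) = ereal v \<longleftrightarrow>
        I = ereal (v - 2 * m * real_of_ereal ?s) \<and> (m = 0 \<or> \<bar>?s\<bar> \<noteq> \<infinity>)" if "0 \<le> m" for I m
      using that by (cases "m = 0"; cases I; cases ?s) auto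
    then show ?thesis
      unfolding D by (simp add: measure_nonneg)
  qed
  also have "\<dots> \<longleftrightarrow> (AE x in M. \<bar>h x\<bar> \<noteq> \<infinity>) \<and> (prob ?Z = 0 \<or> \<bar>?s\<bar> \<noteq> \<infinity>) \<and>
      has_bochner_integral M (\<lambda>x. real_of_ereal (h x)) (v - 2 * prob ?Z * real_of_ereal ?s)"
    by (subst ereal_integral_difference_eq_iff) auto
  finally show ?thesis
    unfolding bochner fin[symmetric] by (simp only: conj_assoc)
qed

section \<open>Pairs of probability measures as one measure with a function\<close>

lemma prob_space_density_iff_has_bochner_integral:
  assumes [measurable]: "g \<in> borel_measurable M" and g: "\<And>x. x \<in> space M \<Longrightarrow> 0 \<le> g x"
  shows "prob_space (density M (\<lambda>x. ennreal (g x))) \<longleftrightarrow> has_bochner_integral M g 1"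
proof -
  have "emeasure (density M (\<lambda>x. ennreal (g x))) (space M) = (\<integral>\<^sup>+x. ennreal (g x) \<partial>M)"
    by (subst emeasure_density) (auto intro!: nn_integral_cong)
  then have "prob_space (density M (\<lambda>x. ennreal (g x))) \<longleftrightarrow> (\<integral>\<^sup>+x. ennreal (g x) \<partial>M) = ennreal 1"
    by (auto intro!: prob_spaceI dest: prob_space.emeasure_space_1)
  also have "\<dots> \<longleftrightarrow> has_bochner_integral M g 1"
  proof
    assume "(\<integral>\<^sup>+x. ennreal (g x) \<partial>M) = ennreal 1"
    then show "has_bochner_integral M g 1"
      using g by (intro has_bochner_integral_nn_integral) auto
  next
    assume "has_bochner_integral M g 1"
    then show "(\<integral>\<^sup>+x. ennreal (g x) \<partial>M) = ennreal 1"
      using g by (subst nn_integral_eq_integral) (auto simp: has_bochner_integral_iff)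
  qed
  finally show ?thesis .
qed

lemma prob_space_pair_midpoint:
  assumes P: "prob_space P" and Q: "prob_space Q" and s: "sets P = sets Q"
  obtains M a where "prob_space M" "sets M = sets P" "a \<in> borel_measurable M"
    "\<And>x. x \<in> space M \<Longrightarrow> 0 \<le> a x \<and> a x \<le> 1"
    "P = density M (\<lambda>x. ennreal (2 * (1 - a x)))" "Q = density M (\<lambda>x. ennreal (2 * a x))"
proof -
  obtain L p q where d: "common_densities L p q P Q"
    using common_densities_exist[OF assms] by blast
  have [measurable]: "p \<in> borel_measurable L" "q \<in> borel_measurable L"
    and nn: "\<And>x. x \<in> space L \<Longrightarrow> 0 \<le> p x \<and> 0 \<le> q x"
    and PL: "P = density L (\<lambda>x. ennreal (p x))" and QL: "Q = density L (\<lambda>x. ennreal (q x))"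
    using d by (auto simp: common_densities_def)
  define m where "m x = (p x + q x) / 2" for x
  \<comment> \<open>Where p + q = 0 the division yields a = 0, and m = 0 there, so the identities m
    * 2a = q and m * 2(1 - a) = p still hold.\<close>
  define a where "a x = q x / (p x + q x)" for x
  have [measurable]: "m \<in> borel_measurable L" "a \<in> borel_measurable L"
    unfolding m_def a_def by measurable
  let ?M = "density L (\<lambda>x. ennreal (m x))"
  have dd: "density ?M (\<lambda>x. ennreal (g x)) = density L (\<lambda>x. ennreal (h x))"
    if [measurable]: "g \<in> borel_measurable L" "h \<in> borel_measurable L"
      and gh: "\<And>x. x \<in> space L \<Longrightarrow> 0 \<le> g x \<and> m x * g x = h x" for g h
  proof -
    have "ennreal (m x) * ennreal (g x) = ennreal (h x)" if "x \<in> space L" for x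
      using gh[OF that] by (metis ennreal_mult'')
    then show ?thesis
      by (subst density_density_eq) (auto intro!: density_cong)
  qed
  have a: "0 \<le> a x \<and> a x \<le> 1" if "x \<in> space L" for x
    using nn[OF that] by (auto simp: a_def divide_le_eq_1)
  have ma: "m x * (2 * (1 - a x)) = p x" "m x * (2 * a x) = q x" if "x \<in> space L" for x
  proof -
    show "m x * (2 * a x) = q x"
      using nn[OF that] by (cases "p x + q x = 0") (auto simp: m_def a_def)
    moreover have "m x * (2 * (1 - a x)) = 2 * m x - m x * (2 * a x)"
      by (simp add: algebra_simps)
    moreover have "2 * m x = p x + q x"
      by (simp add: m_def)
    ultimately show "m x * (2 * (1 - a x)) = p x"
      by linarith
  qed
  show thesis
  proof
    have "has_bochner_integral L p 1" "has_bochner_integral L q 1"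
      using P Q nn unfolding PL QL by (simp_all add: prob_space_density_iff_has_bochner_integral)
    from has_bochner_integral_mult_right[OF has_bochner_integral_add[OF this], of "1/2"]
    have "has_bochner_integral L m 1"
      by (simp add: m_def[abs_def])
    then show "prob_space ?M"
      using nn by (subst prob_space_density_iff_has_bochner_integral) (auto simp: m_def)
    show "sets ?M = sets P"
      by (simp add: PL)
    show "P = density ?M (\<lambda>x. ennreal (2 * (1 - a x)))" "Q = density ?M (\<lambda>x. ennreal (2 * a x))"
      unfolding PL QL using a ma by (auto intro!: dd[symmetric])
  qed (use a in auto)
qed

text \<open>All conditions depend only on the law of \<open>a\<close> under \<open>M\<close>. The
  mean 1/2 encodes both normalisations: it makes 2a and 2(1 - a) probability densities.\<close>

definition divergence_profile ::
  "'a measure \<Rightarrow> ('a \<Rightarrow> real) \<Rightarrow> ('m::finite \<Rightarrow> real \<Rightarrow> real) \<Rightarrow> real ^ 'm \<Rightarrow> bool" where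
  "divergence_profile M a f v \<longleftrightarrow>
     prob_space M \<and> a \<in> borel_measurable M \<and> (\<forall>x\<in>space M. 0 \<le> a x \<and> a x \<le> 1) \<and>
     has_bochner_integral M a (1 / 2) \<and>
     (\<forall>i. (AE x in M. \<bar>f_perspective (f i) (a x)\<bar> \<noteq> \<infinity>) \<and>
       has_bochner_integral M (\<lambda>x. real_of_ereal (f_perspective (f i) (a x))) (v $ i / 2))"

text \<open>The measure \<open>N\<close> only carries a sigma-algebra. Both translations preserve
  it, so one equivalence serves arbitrary spaces as well as the discrete space on {1..m+2}.\<close>

lemma ex_divergences_iff_ex_profile:
  fixes f :: "'m::finite \<Rightarrow> real \<Rightarrow> real"
  assumes f: "\<And>i. (\<lambda>x. indicator {0<..} x *\<^sub>R f i x) \<in> borel_measurable borel"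
  shows "(\<exists>P Q. prob_space P \<and> prob_space Q \<and> sets P = sets N \<and> sets Q = sets N \<and>
      (\<forall>i. ereal (v $ i) = f_divergence (f i) P Q)) \<longleftrightarrow>
    (\<exists>M a. sets M = sets N \<and> divergence_profile M a f v)"
    (is "?L \<longleftrightarrow> ?R")
proof
  assume ?L
  then obtain P Q where PQ: "prob_space P" "prob_space Q" "sets P = sets N" "sets Q = sets N"
      "\<And>i. f_divergence (f i) P Q = ereal (v $ i)"
    by metis
  then obtain M a where M: "prob_space M" "sets M = sets P" "a \<in> borel_measurable M"
    "\<And>x. x \<in> space M \<Longrightarrow> 0 \<le> a x \<and> a x \<le> 1"
    "P = density M (\<lambda>x. ennreal (2 * (1 - a x)))" "Q = density M (\<lambda>x. ennreal (2 * a x))"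
    using prob_space_pair_midpoint[of P Q] by metis
  have "has_bochner_integral M (\<lambda>x. 2 * a x) 1"
    using PQ(2) M(3,4) unfolding M(6)
    by (subst (asm) prob_space_density_iff_has_bochner_integral) auto
  from has_bochner_integral_mult_right[OF this, of "1/2"]
  have "has_bochner_integral M a (1 / 2)"
    by simp
  then have "divergence_profile M a f v"
    using M(1,3,4) PQ(5) f_divergence_eq_ereal_iff[OF M(1,3,4,5,6) PQ(1) f]
    unfolding divergence_profile_def by blast
  then show ?R
    using M(2) PQ(3) by auto
next
  assume ?R
  then obtain M a where s: "sets M = sets N" and M: "prob_space M" "a \<in> borel_measurable M"
      and a: "\<And>x. x \<in> space M \<Longrightarrow> 0 \<le> a x \<and> a x \<le> 1"
      and half: "has_bochner_integral M a (1 / 2)"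
      and v: "\<And>i. (AE x in M. \<bar>f_perspective (f i) (a x)\<bar> \<noteq> \<infinity>) \<and>
        has_bochner_integral M (\<lambda>x. real_of_ereal (f_perspective (f i) (a x))) (v $ i / 2)"
    unfolding divergence_profile_def by blast
  interpret prob_space M by fact
  let ?P = "density M (\<lambda>x. ennreal (2 * (1 - a x)))" and ?Q = "density M (\<lambda>x. ennreal (2 * a x))"
  have q: "has_bochner_integral M (\<lambda>x. 2 * a x) 1"
    using has_bochner_integral_mult_right[OF half, of 2] by simp
  have "has_bochner_integral M (\<lambda>x. 1 :: real) 1"
    by (simp add: has_bochner_integral_iff prob_space)
  from has_bochner_integral_diff[OF has_bochner_integral_mult_right[OF this, of 2] q]
  have p: "has_bochner_integral M (\<lambda>x. 2 * (1 - a x)) 1"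
    by (simp add: right_diff_distrib)
  have P: "prob_space ?P" and Q: "prob_space ?Q"
    using p q a M(2) by (auto simp: prob_space_density_iff_has_bochner_integral)
  have "ereal (v $ i) = f_divergence (f i) ?P ?Q" for i
    using f_divergence_eq_ereal_iff[OF M a refl refl P f] v by metis
  then show ?L
    using P Q s by (intro exI[of _ ?P] exI[of _ ?Q]) auto
qed

section \<open>Transport of profiles and reduction to finitely many atoms\<close>

text \<open>Since \<open>a\<close> factors through \<open>e\<close>, the law of \<open>b\<close>
  under the image measure is that of \<open>a\<close> under \<open>M\<close>. As \<open>N\<close> is
  discrete, every function on it is measurable. This serves to move a finitely supported profile to
  another type.\<close>

lemma divergence_profile_distr:
  assumes M: "divergence_profile M a f v" and e[measurable]: "e \<in> measurable M N"
    and b[measurable]: "b \<in> borel_measurable N" and N: "sets N = Pow (space N)"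
    and ba: "\<And>x. x \<in> space M \<Longrightarrow> b (e x) = a x" and bN: "\<And>y. y \<in> space N \<Longrightarrow> 0 \<le> b y \<and> b y \<le> 1"
  shows "divergence_profile (distr M N e) b f v"
proof -
  have meas: "g \<in> borel_measurable N" for g :: "_ \<Rightarrow> real"
    by (auto simp: measurable_def N)
  have bochner: "has_bochner_integral (distr M N e) g c"
    if "has_bochner_integral M h c" "\<And>x. x \<in> space M \<Longrightarrow> g (e x) = h x" for g h and c :: real
    using that has_bochner_integral_cong[of M M "\<lambda>x. g (e x)" h c c]
    by (intro has_bochner_integral_distr meas e) auto
  have AE: "AE y in distr M N e. R (b y)" if "AE x in M. R (a x)" for R
    using that ba by (subst AE_distr_iff) (auto simp: N cong: AE_cong)
  show ?thesis
    using M bN unfolding divergence_profile_def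
    by (auto intro!: prob_space.prob_space_distr AE bochner simp: ba)
qed

lemma divergence_profile_finite_support:
  fixes f :: "'m::finite \<Rightarrow> real \<Rightarrow> real"
  assumes "divergence_profile M a f v"
  shows "\<exists>N b. sets N = Pow {1..CARD('m) + 2} \<and> divergence_profile (N :: nat measure) b f v"
proof -
  let ?w = "\<lambda>i t. real_of_ereal (f_perspective (f i) t)"
  let ?c = "\<lambda>t. (t, \<chi> i. ?w i t) :: real \<times> (real ^ 'm)"
  define C where "C = {?c t | t. 0 \<le> t \<and> t \<le> 1 \<and> (\<forall>i. \<bar>f_perspective (f i) t\<bar> \<noteq> \<infinity>)}"
  let ?z = "(1 / 2, \<chi> i. v $ i / 2) :: real \<times> (real ^ 'm)"
  interpret prob_space M
    using assms by (simp add: divergence_profile_def)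
  have a: "\<And>x. x \<in> space M \<Longrightarrow> 0 \<le> a x \<and> a x \<le> 1"
    and half: "has_bochner_integral M a (1 / 2)"
    and fin: "\<And>i. AE x in M. \<bar>f_perspective (f i) (a x)\<bar> \<noteq> \<infinity>"
    and v: "\<And>i. has_bochner_integral M (\<lambda>x. ?w i (a x)) (v $ i / 2)"
    using assms by (auto simp: divergence_profile_def)
  \<comment> \<open>A finite combination of fixed vectors, so that the vector-valued mean follows
    from the scalar means.\<close>
  have coords: "(t, \<chi> i. g i) = t *\<^sub>R (1, 0) + (\<Sum>i\<in>UNIV. g i *\<^sub>R (0, axis i 1))"
    for t and g :: "'m \<Rightarrow> real"
    by (simp add: prod_eq_iff fst_sum snd_sum vec_eq_iff axis_def if_distrib cong: if_cong)
  have z: "has_bochner_integral M (\<lambda>x. ?c (a x)) ?z"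
    unfolding coords
    by (intro has_bochner_integral_add has_bochner_integral_sum has_bochner_integral_scaleR_left half v)
  have "AE x in M. \<forall>i. \<bar>f_perspective (f i) (a x)\<bar> \<noteq> \<infinity>"
    using fin by (simp add: AE_all_countable)
  then have "AE x in M. ?c (a x) \<in> C"
    using AE_space by eventually_elim (use a in \<open>auto simp: C_def\<close>)
  then have "?z \<in> convex hull C"
    using expectation_in_convex_hull[of "\<lambda>x. ?c (a x)" C] z by (simp add: has_bochner_integral_iff)
  \<comment> \<open>The curve lies in a space of dimension m + 1, for which Caratheodory's theorem
    gives at most m + 2 points.\<close>
  then obtain T where T: "finite T" "T \<subseteq> C" "card T \<le> CARD('m) + 2" "?z \<in> convex hull T"
    unfolding caratheodory[of C] by auto
  then obtain u where u: "\<And>y. y \<in> T \<Longrightarrow> 0 \<le> u y" "sum u T = 1" "(\<Sum>y\<in>T. u y *\<^sub>R y) = ?z"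
    unfolding convex_hull_finite[OF T(1)] by auto
  obtain e where e: "bij_betw e {1..card T} T"
    using ex_bij_betw_nat_finite_1[OF T(1)] by blast
  let ?K = "{1..CARD('m) + 2}"
  \<comment> \<open>Indices beyond \<open>card T\<close> are padding up to m + 2 points: they get
    mass 0, and the default 0 keeps \<open>b\<close> in [0, 1]. The perspective may be infinite
    there without affecting the almost-everywhere clause.\<close>
  define b where "b j = (if j \<in> {1..card T} then fst (e j) else 0)" for j
  define c where "c j = (if j \<in> {1..card T} then u (e j) else 0)" for j
  let ?N = "point_measure ?K (\<lambda>j. ennreal (c j))"
  have eT: "e j \<in> T" if "j \<in> {1..card T}" for j
    using e that by (auto simp: bij_betw_def)
  have eC: "e j = ?c (b j) \<and> 0 \<le> b j \<and> b j \<le> 1 \<and> (\<forall>i. \<bar>f_perspective (f i) (b j)\<bar> \<noteq> \<infinity>)"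
    if "j \<in> {1..card T}" for j
  proof -
    have "e j \<in> C"
      using eT[OF that] T(2) by blast
    then obtain t where t: "e j = ?c t" "0 \<le> t" "t \<le> 1" "\<forall>i. \<bar>f_perspective (f i) t\<bar> \<noteq> \<infinity>"
      unfolding C_def by blast
    then have "b j = t"
      using that by (simp add: b_def)
    with t show ?thesis
      by simp
  qed
  have c0: "0 \<le> c j" for j
    using u(1) eT by (simp add: c_def)
  have bij_sum: "(\<Sum>j\<in>?K. c j *\<^sub>R g (b j)) = (\<Sum>y\<in>T. u y *\<^sub>R g (fst y))" for g :: "real \<Rightarrow> real"
  proof -
    have "(\<Sum>j\<in>?K. c j *\<^sub>R g (b j)) = (\<Sum>j\<in>{1..card T}. u (e j) *\<^sub>R g (fst (e j)))"
      using T(3) by (intro sum.mono_neutral_cong_right) (auto simp: b_def c_def)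
    also have "\<dots> = (\<Sum>y\<in>T. u y *\<^sub>R g (fst y))"
      by (rule sum.reindex_bij_betw[OF e])
    finally show ?thesis .
  qed
  have bochner: "has_bochner_integral ?N (\<lambda>j. g (b j)) (\<Sum>y\<in>T. u y *\<^sub>R g (fst y))"
    for g :: "real \<Rightarrow> real"
    unfolding bij_sum[symmetric] using c0
    by (simp add: has_bochner_integral_iff integrable_point_measure_finite
        lebesgue_integral_point_measure_finite)
  have b01: "0 \<le> b j \<and> b j \<le> 1" for j
    using eC[of j] by (cases "j \<in> {1..card T}") (auto simp: b_def)
  have sum1: "(\<Sum>j\<in>?K. c j) = 1"
    using bij_sum[of "\<lambda>_. 1"] u(2) by simp
  have "prob_space ?N"
  proof (rule prob_space_point_measure)
    show "(\<Sum>j\<in>?K. ennreal (c j)) = 1"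
      by (subst sum_ennreal) (simp_all only: c0 sum1 ennreal_1)
  qed auto
  moreover have "has_bochner_integral ?N b (1 / 2)"
  proof -
    have "(\<Sum>y\<in>T. u y *\<^sub>R fst y) = 1 / 2"
      using arg_cong[OF u(3), of fst] by (simp add: fst_sum)
    then show ?thesis
      using bochner[of "\<lambda>t. t"] by (simp only:)
  qed
  moreover have "has_bochner_integral ?N (\<lambda>j. ?w i (b j)) (v $ i / 2)" for i
  proof -
    \<comment> \<open>Points of \<open>T\<close> lie on the curve, so coordinate \<open>i\<close> of
      the second component is the perspective at the first component.\<close>
    have "(\<Sum>y\<in>T. u y *\<^sub>R ?w i (fst y)) = (\<Sum>y\<in>T. u y *\<^sub>R snd y $ i)"
      using T(2) by (intro sum.cong) (auto simp: C_def)
    also have "\<dots> = v $ i / 2"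
      using arg_cong[OF u(3), of "\<lambda>y. snd y $ i"] by (simp add: snd_sum)
    finally show ?thesis
      using bochner[of "?w i"] by (simp only:)
  qed
  moreover have "AE j in ?N. \<bar>f_perspective (f i) (b j)\<bar> \<noteq> \<infinity>" for i
    using eC by (auto simp: AE_point_measure c_def split: if_splits)
  ultimately have "divergence_profile ?N b f v"
    unfolding divergence_profile_def using b01 by (auto simp: measurable_def sets_point_measure space_point_measure)
  moreover have "sets ?N = Pow ?K"
    by (simp add: sets_point_measure)
  ultimately show ?thesis
    by blast
qed

section \<open>Comparison of the joint ranges\<close>

text \<open>The inclusion into the finite range holds over every type \<open>'a\<close>. For the
  converse, the m + 2 atoms have to be placed in \<open>'a\<close>, and an infinite type has room
  for them for every m.\<close>

theorem theorem4p1: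
  fixes f :: "'m::finite \<Rightarrow> real \<Rightarrow> real"
  assumes "\<And>i. convex_on {0<..} (f i)"
    and "\<And>i. f i 1 = 0"
  shows "joint_range TYPE('a) f \<subseteq> joint_range_upto (CARD('m) + 2) f \<and>
    (infinite (UNIV :: 'a set) \<longrightarrow>
       joint_range TYPE('a) f = joint_range_upto (CARD('m) + 2) f)"
proof -
  let ?K = "{1..CARD('m) + 2}"
  \<comment> \<open>Convexity on an open interval gives continuity there, hence measurability of the
    truncation.\<close>
  have meas: "(\<lambda>x. indicator {0<..} x *\<^sub>R f i x) \<in> borel_measurable borel" for i
    using assms(1)[of i] by (intro borel_measurable_continuous_on_indicator convex_on_continuous) auto
  have R: "v \<in> joint_range TYPE('a) f \<longleftrightarrow> (\<exists>(M :: 'a measure) a. divergence_profile M a f v)" for v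
  proof -
    have "v \<in> joint_range TYPE('a) f \<longleftrightarrow>
        (\<exists>N P Q :: 'a measure. prob_space P \<and> prob_space Q \<and> sets P = sets N \<and> sets Q = sets N \<and>
          (\<forall>i. ereal (v $ i) = f_divergence (f i) P Q))"
      unfolding joint_range_def by blast
    also have "\<dots> \<longleftrightarrow> (\<exists>(N :: 'a measure) M a. sets M = sets N \<and> divergence_profile M a f v)"
      by (simp only: ex_divergences_iff_ex_profile[OF meas])
    finally show ?thesis
      by blast
  qed
  have Rk: "v \<in> joint_range_upto (CARD('m) + 2) f \<longleftrightarrow>
      (\<exists>(M :: nat measure) a. sets M = Pow ?K \<and> divergence_profile M a f v)" for v
  proof -
    have "space P = ?K" if "sets P = Pow ?K" for P :: "nat measure"
      using sets_eq_imp_space_eq[of P "count_space ?K"] that by simp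
    then have "v \<in> joint_range_upto (CARD('m) + 2) f \<longleftrightarrow>
        (\<exists>P Q :: nat measure. prob_space P \<and> prob_space Q \<and> sets P = sets (count_space ?K) \<and>
          sets Q = sets (count_space ?K) \<and> (\<forall>i. ereal (v $ i) = f_divergence (f i) P Q))"
      unfolding joint_range_upto_def prob_measures_upto_def sets_count_space by blast
    then show ?thesis
      unfolding ex_divergences_iff_ex_profile[OF meas] by simp
  qed
  have "joint_range TYPE('a) f \<subseteq> joint_range_upto (CARD('m) + 2) f"
  proof
    fix v assume "v \<in> joint_range TYPE('a) f"
    then obtain M :: "'a measure" and a where "divergence_profile M a f v"
      unfolding R by blast
    then show "v \<in> joint_range_upto (CARD('m) + 2) f"
      unfolding Rk by (rule divergence_profile_finite_support)
  qed
  moreover have "joint_range_upto (CARD('m) + 2) f \<subseteq> joint_range TYPE('a) f"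
    if inf: "infinite (UNIV :: 'a set)"
  proof
    fix v assume "v \<in> joint_range_upto (CARD('m) + 2) f"
    then obtain M :: "nat measure" and a
      where M: "sets M = Pow ?K" and prof: "divergence_profile M a f v"
      unfolding Rk by blast
    have sp: "space M = ?K"
      using sets_eq_imp_space_eq[of M "count_space ?K"] M by simp
    obtain e :: "nat \<Rightarrow> 'a" where e: "inj e"
      using infinite_countable_subset[OF inf] by blast
    \<comment> \<open>The atoms are carried along the injection \<open>e\<close> to a discrete space
      inside \<open>'a\<close>; on its image \<open>inv e\<close> recovers the index, and with it
      the value of \<open>a\<close>.\<close>
    have "divergence_profile (distr M (count_space (e ` ?K)) e) (\<lambda>y. a (inv e y)) f v"
      using e prof by (intro divergence_profile_distr[OF prof])
        (auto simp: M sp measurable_def divergence_profile_def)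
    then show "v \<in> joint_range TYPE('a) f"
      unfolding R by blast
  qed
  ultimately show ?thesis
    by blast
qed

end
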